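(* Let $\mathcal{F}$ be a sequence of $n$ conditional events, let $\Pi\subseteq[0,1]^n$ be the set of all coherent precise assessments on $\mathcal{F}$, and let $\pi(\mathcal{I})=\Pi\cap\mathcal{I}$ for $\mathcal{I}\subseteq[0,1]^n$. (1) If $(s_1,s_2,s_3,s_4,s_5,s_6)$, with $s_k:(\mathcal{F},\mathcal{I}_k)$, $\mathcal{I}_k\subseteq[0,1]^n$, is a hexagon of opposition, then $(\pi(\mathcal{I}_1),\pi(\mathcal{I}_2),\pi(\mathcal{I}_6))$ is a tripartition of $\Pi$. (2) Conversely, if $(\mathcal{D}_1,\mathcal{D}_2,\mathcal{D}_3)$ is a tripartition of $\Pi$, then every tuple $(s_1,s_2,s_3,s_4,s_5,s_6)$ of sentences $s_k:(\mathcal{F},\mathcal{I}_k)$, $k=1,\ldots,6$, with $\pi(\mathcal{I}_1)=\mathcal{D}_1$, $\pi(\mathcal{I}_2)=\mathcal{D}_2$, $\pi(\mathcal{I}_3)=\mathcal{D}_1\cup\mathcal{D}_3$, $\pi(\mathcal{I}_4)=\mathcal{D}_2\cup\mathcal{D}_3$, $\pi(\mathcal{I}_5)=\mathcal{D}_1\cup\mathcal{D}_2$, and $\pi(\mathcal{I}_6)=\mathcal{D}_3$ is a hexagon of opposition.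
   Context: Events are two-valued logical entities (they can be modelled as subsets of a nonempty set $\Omega$ of possible cases); an event is identified with its indicator in $\{0,1\}$. A conditional event $E|H$ is given by events $E,H$ with $H\neq\bot$ (impossible event). Given $\mathcal{F}=(E_1|H_1,\ldots,E_n|H_n)$, a precise assessment on $\mathcal{F}$ is a vector $\mathcal{P}=(p_1,\ldots,p_n)$, $p_i=p(E_i|H_i)$. It is coherent iff for every nonempty subfamily, indexed by $J\subseteq\{1,\ldots,n\}$, and all real numbers $s_j$ ($j\in J$), the random gain $\mathcal{G}=\sum_{j\in J}s_jH_j(E_j-p_j)$ satisfies $\min G\le 0\le\max G$, where $G$ is the set of values of $\mathcal{G}$ restricted to $\bigvee_{j\in J}H_j$ being true. $\Pi$ denotes the set of all coherent precise assessments on $\mathcal{F}$; it is known that $\emptyset\neq\Pi\subseteq[0,1]^n$. A sentence is a pair $s:(\mathcal{F},\mathcal{I})$ with $\mathcal{I}\subseteq[0,1]^n$ (possibly empty). Operations: $s_1\wedge s_2:(\mathcal{F},\mathcal{I}_1\cap\mathcal{I}_2)$, $s_1\vee s_2:(\mathcal{F},\mathcal{I}_1\cup\mathcal{I}_2)$. Sentences $s:(\mathcal{F},\mathcal{I})$ and $s':(\mathcal{F},\mathcal{I}')$ are equivalent under t-coherence, $s\equiv s'$, iff $\pi(\mathcal{I})=\pi(\mathcal{I}')$. A quadruple $(s_1,s_2,s_3,s_4)$ of sentences $s_k:(\mathcal{F},\mathcal{I}_k)$ is a square of opposition iff: (a) (contraries) $\pi(\mathcal{I}_1)\cap\pi(\mathcal{I}_2)=\emptyset$;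 (b) (subcontraries) $\pi(\mathcal{I}_3)\cup\pi(\mathcal{I}_4)=\Pi$; (c) (contradictories) $\pi(\mathcal{I}_1)\cap\pi(\mathcal{I}_4)=\emptyset$, $\pi(\mathcal{I}_1)\cup\pi(\mathcal{I}_4)=\Pi$, $\pi(\mathcal{I}_2)\cap\pi(\mathcal{I}_3)=\emptyset$, $\pi(\mathcal{I}_2)\cup\pi(\mathcal{I}_3)=\Pi$; (d) (subalterns) $\pi(\mathcal{I}_1)\subseteq\pi(\mathcal{I}_3)$ and $\pi(\mathcal{I}_2)\subseteq\pi(\mathcal{I}_4)$. A tuple $(s_1,\ldots,s_6)$ of sentences on $\mathcal{F}$ is a hexagon of opposition iff $(s_1,s_2,s_3,s_4)$ is a square of opposition, $s_5\equiv s_1\vee s_2$, and $s_6\equiv s_3\wedge s_4$. A tripartition of a set $S$ is an ordered triple of (possibly empty) pairwise disjoint subsets of $S$ whose union is $S$. *)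

theory Defs
  imports "HOL-Analysis.Analysis"
begin

text \<open>
  Events are subsets of the nonempty set of possible cases, here the universe of the type
  \<open>'w\<close>.  The pair \<open>(E, H)\<close> stands for the conditional event \<open>E|H\<close>, provided \<open>H \<noteq> {}\<close>.
  A sequence of \<open>n\<close> conditional events is a vector with index type \<open>'n\<close>, \<open>n = CARD('n) \<ge> 1\<close>.
\<close>

type_synonym 'w cond_event = "'w set \<times> 'w set"

definition is_cond_event :: "'w cond_event \<Rightarrow> bool" where
  "is_cond_event C \<longleftrightarrow> snd C \<noteq> {}"

definition random_gain ::
  "('w cond_event)^'n \<Rightarrow> real^'n \<Rightarrow> 'n set \<Rightarrow> ('n \<Rightarrow> real) \<Rightarrow> 'w \<Rightarrow> real" where
  "random_gain F p J s w =
     (\<Sum>j\<in>J. s j * indicator (snd (F $ j)) w * (indicator (fst (F $ j)) w - p $ j))"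

definition gain_values ::
  "('w cond_event)^'n \<Rightarrow> real^'n \<Rightarrow> 'n set \<Rightarrow> ('n \<Rightarrow> real) \<Rightarrow> real set" where
  "gain_values F p J s = random_gain F p J s ` (\<Union>j\<in>J. snd (F $ j))"

text \<open>
  \<open>Min\<close> and \<open>Max\<close> are meaningful here: the set of gain values is always finite, and it is
  nonempty when \<open>J\<close> is nonempty and the conditioning events are possible (proved below).
\<close>

definition coherent :: "('w cond_event)^'n \<Rightarrow> real^'n \<Rightarrow> bool" where
  "coherent F p \<longleftrightarrow>
     (\<forall>J. J \<noteq> {} \<longrightarrow>
        (\<forall>s. Min (gain_values F p J s) \<le> 0 \<and> 0 \<le> Max (gain_values F p J s)))"

definition coherent_assessments :: "('w cond_event)^'n \<Rightarrow> (real^'n) set" where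
  "coherent_assessments F = {p. coherent F p}"

definition unit_hypercube :: "(real^'n) set" where
  "unit_hypercube = {p. \<forall>i. 0 \<le> p $ i \<and> p $ i \<le> 1}"

definition coherent_part :: "('w cond_event)^'n \<Rightarrow> (real^'n) set \<Rightarrow> (real^'n) set" where
  "coherent_part F I = coherent_assessments F \<inter> I"

type_synonym ('w, 'n) sentence = "(('w cond_event)^'n) \<times> (real^'n) set"

definition sentence_on :: "('w cond_event)^'n \<Rightarrow> ('w, 'n) sentence \<Rightarrow> bool" where
  "sentence_on F s \<longleftrightarrow> fst s = F \<and> snd s \<subseteq> unit_hypercube"

text \<open>The two connectives are meant for sentences on the same sequence of conditional events.\<close>

definition sentence_and ::
  "('w, 'n::finite) sentence \<Rightarrow> ('w, 'n) sentence \<Rightarrow> ('w, 'n) sentence" where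
  "sentence_and s t = (fst s, snd s \<inter> snd t)"

definition sentence_or ::
  "('w, 'n::finite) sentence \<Rightarrow> ('w, 'n) sentence \<Rightarrow> ('w, 'n) sentence" where
  "sentence_or s t = (fst s, snd s \<union> snd t)"

definition t_equivalent :: "('w, 'n::finite) sentence \<Rightarrow> ('w, 'n) sentence \<Rightarrow> bool" where
  "t_equivalent s t \<longleftrightarrow>
     fst s = fst t \<and> coherent_part (fst s) (snd s) = coherent_part (fst t) (snd t)"

definition contraries ::
  "('w cond_event)^'n \<Rightarrow> ('w, 'n) sentence \<Rightarrow> ('w, 'n) sentence \<Rightarrow> bool" where
  "contraries F s t \<longleftrightarrow> coherent_part F (snd s) \<inter> coherent_part F (snd t) = {}"

definition subcontraries ::
  "('w cond_event)^'n \<Rightarrow> ('w, 'n) sentence \<Rightarrow> ('w, 'n) sentence \<Rightarrow> bool" where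
  "subcontraries F s t \<longleftrightarrow>
     coherent_part F (snd s) \<union> coherent_part F (snd t) = coherent_assessments F"

definition contradictories ::
  "('w cond_event)^'n \<Rightarrow> ('w, 'n) sentence \<Rightarrow> ('w, 'n) sentence \<Rightarrow> bool" where
  "contradictories F s t \<longleftrightarrow>
     coherent_part F (snd s) \<inter> coherent_part F (snd t) = {} \<and>
     coherent_part F (snd s) \<union> coherent_part F (snd t) = coherent_assessments F"

definition subaltern ::
  "('w cond_event)^'n \<Rightarrow> ('w, 'n) sentence \<Rightarrow> ('w, 'n) sentence \<Rightarrow> bool" where
  "subaltern F s t \<longleftrightarrow> coherent_part F (snd s) \<subseteq> coherent_part F (snd t)"

definition square_of_opposition ::
  "('w cond_event)^'n \<Rightarrow> ('w, 'n) sentence \<Rightarrow> ('w, 'n) sentence \<Rightarrow>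
   ('w, 'n) sentence \<Rightarrow> ('w, 'n) sentence \<Rightarrow> bool" where
  "square_of_opposition F s1 s2 s3 s4 \<longleftrightarrow>
     sentence_on F s1 \<and> sentence_on F s2 \<and> sentence_on F s3 \<and> sentence_on F s4 \<and>
     contraries F s1 s2 \<and>
     subcontraries F s3 s4 \<and>
     contradictories F s1 s4 \<and> contradictories F s2 s3 \<and>
     subaltern F s1 s3 \<and> subaltern F s2 s4"

definition hexagon_of_opposition ::
  "('w cond_event)^'n \<Rightarrow> ('w, 'n) sentence \<Rightarrow> ('w, 'n) sentence \<Rightarrow> ('w, 'n) sentence \<Rightarrow>
   ('w, 'n) sentence \<Rightarrow> ('w, 'n) sentence \<Rightarrow> ('w, 'n) sentence \<Rightarrow> bool" where
  "hexagon_of_opposition F s1 s2 s3 s4 s5 s6 \<longleftrightarrow>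
     square_of_opposition F s1 s2 s3 s4 \<and>
     sentence_on F s5 \<and> sentence_on F s6 \<and>
     t_equivalent s5 (sentence_or s1 s2) \<and>
     t_equivalent s6 (sentence_and s3 s4)"

definition tripartition :: "'a set \<Rightarrow> 'a set \<times> 'a set \<times> 'a set \<Rightarrow> bool" where
  "tripartition S D \<longleftrightarrow> (case D of (D1, D2, D3) \<Rightarrow>
     D1 \<inter> D2 = {} \<and> D1 \<inter> D3 = {} \<and> D2 \<inter> D3 = {} \<and> D1 \<union> D2 \<union> D3 = S)"

lemma finite_gain_values:
  fixes F :: "('w cond_event)^'n"
  shows "finite (gain_values F p J s)"
proof -
  define a where "a w = ({j. w \<in> fst (F $ j)}, {j. w \<in> snd (F $ j)})" for w
  define g where "g X = (\<Sum>j\<in>J. s j * indicator (snd X) j * (indicator (fst X) j - p $ j))"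
    for X :: "'n set \<times> 'n set"
  have "random_gain F p J s w = g (a w)" for w
    by (simp add: random_gain_def g_def a_def indicator_def)
  then have "gain_values F p J s \<subseteq> range g"
    by (auto simp: gain_values_def)
  moreover have "finite (range g)" by simp
  ultimately show ?thesis by (rule finite_subset)
qed

lemma gain_values_nonempty:
  assumes "\<forall>i. is_cond_event (F $ i)" "J \<noteq> {}"
  shows "gain_values F p J s \<noteq> {}"
  using assms by (auto simp: gain_values_def is_cond_event_def)

lemma coherent_assessments_subset:
  assumes "\<forall>i. is_cond_event (F $ i)"
  shows "coherent_assessments F \<subseteq> unit_hypercube"
proof
  fix p assume "p \<in> coherent_assessments F"
  then have c: "Min (gain_values F p {i} (\<lambda>_. 1)) \<le> 0"
      "0 \<le> Max (gain_values F p {i} (\<lambda>_. 1))" for i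
    by (simp_all add: coherent_assessments_def coherent_def)
  have b: "x \<in> {- p $ i, 1 - p $ i}" if "x \<in> gain_values F p {i} (\<lambda>_. 1)" for x i
    using that by (auto simp: gain_values_def random_gain_def indicator_def)
  have "0 \<le> p $ i \<and> p $ i \<le> 1" for i
  proof -
    have ne: "gain_values F p {i} (\<lambda>_. 1) \<noteq> {}"
      by (rule gain_values_nonempty[OF assms]) simp
    show ?thesis
      using c[of i] b[OF Min_in[OF finite_gain_values ne]] b[OF Max_in[OF finite_gain_values ne]]
      by auto
  qed
  then show "p \<in> unit_hypercube" by (simp add: unit_hypercube_def)
qed

lemma coherent_assessments_nonempty:
  fixes F :: "('w cond_event)^'n"
  assumes "\<forall>i. is_cond_event (F $ i)"
  shows "coherent_assessments F \<noteq> {}"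
proof -
  obtain r :: "('w \<times> 'w) set" where r: "well_order_on UNIV r"
    using well_order_on by blast
  then have wf: "wf (r - Id)" and lin: "total_on UNIV r"
    by (auto simp: well_order_on_def linear_order_on_def)
  have least: "\<exists>w\<in>A. \<forall>v. (v, w) \<in> r - Id \<longrightarrow> v \<notin> A" if "A \<noteq> {}" for A :: "'w set"
    using wf that by (meson ex_in_conv wfE_min)
  have tot: "v = w \<or> (v, w) \<in> r - Id \<or> (w, v) \<in> r - Id" for v w
    using lin by (auto simp: total_on_def)
  define l where "l A = (SOME w. w \<in> A \<and> (\<forall>v. (v, w) \<in> r - Id \<longrightarrow> v \<notin> A))" for A :: "'w set"
  have l: "l A \<in> A \<and> (\<forall>v. (v, l A) \<in> r - Id \<longrightarrow> v \<notin> A)" if "A \<noteq> {}" for A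
    unfolding l_def by (rule someI_ex) (use least[OF that] in blast)
  define p :: "real^'n" where "p = (\<chi> i. indicator (fst (F $ i)) (l (snd (F $ i))))"
  have "coherent F p"
    unfolding coherent_def
  proof (intro allI impI)
    fix J :: "'n set" and s :: "'n \<Rightarrow> real"
    assume J: "J \<noteq> {}"
    define U where "U = (\<Union>j\<in>J. snd (F $ j))"
    have U: "U \<noteq> {}" using assms J by (auto simp: U_def is_cond_event_def)
    have "l U = l (snd (F $ j))" if "j \<in> J" "l U \<in> snd (F $ j)" for j
    proof -
      have "snd (F $ j) \<noteq> {}" "snd (F $ j) \<subseteq> U" using that by (auto simp: U_def)
      then show ?thesis using l[OF U] l[of "snd (F $ j)"] tot that(2) by blast
    qed
    then have "random_gain F p J s (l U) = 0"
      unfolding random_gain_def by (intro sum.neutral) (auto simp: p_def indicator_def)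
    moreover have "l U \<in> U" using l[OF U] by blast
    ultimately have "0 \<in> gain_values F p J s"
      unfolding gain_values_def U_def by (metis image_eqI)
    then show "Min (gain_values F p J s) \<le> 0 \<and> 0 \<le> Max (gain_values F p J s)"
      by (simp add: Min_le[OF finite_gain_values] Max_ge[OF finite_gain_values])
  qed
  then show ?thesis by (auto simp: coherent_assessments_def)
qed

end

theory Submission
  imports Defs
begin

text \<open>
  On coherent parts, contradictoriness is complementation inside the set \<open>\<Pi>\<close> of coherent
  assessments.  A hexagon of opposition is therefore determined, up to t-equivalence, by the
  coherent parts \<open>A\<^sub>1\<close>, \<open>A\<^sub>2\<close> of its two contraries: \<open>A\<^sub>3 = \<Pi> - A\<^sub>2\<close> and \<open>A\<^sub>4 = \<Pi> - A\<^sub>1\<close> are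
  forced, \<open>A\<^sub>5 = A\<^sub>1 \<union> A\<^sub>2\<close> by definition, and by De Morgan \<open>A\<^sub>6 = A\<^sub>3 \<inter> A\<^sub>4\<close> is the part of
  \<open>\<Pi>\<close> outside \<open>A\<^sub>1 \<union> A\<^sub>2\<close>.  Subcontrariety and both subalternations are dual forms of
  \<open>A\<^sub>1 \<inter> A\<^sub>2 = {}\<close>, so the only constraint left is that disjointness; this is
  \<open>hexagon_of_opposition_iff\<close>.  Disjoint \<open>A\<^sub>1\<close>, \<open>A\<^sub>2\<close> together with the remainder \<open>A\<^sub>6\<close> are
  the same data as a tripartition of \<open>\<Pi>\<close>, and both directions follow by Boolean algebra.
\<close>

lemma coherent_part_subset: "coherent_part F I \<subseteq> coherent_assessments F"
  by (simp add: coherent_part_def)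

lemma coherent_part_Int:
  "coherent_part F (I \<inter> K) = coherent_part F I \<inter> coherent_part F K"
  by (auto simp: coherent_part_def)

lemma coherent_part_Un:
  "coherent_part F (I \<union> K) = coherent_part F I \<union> coherent_part F K"
  by (auto simp: coherent_part_def)

lemma contradictories_iff_complement:
  "contradictories F s t \<longleftrightarrow>
     coherent_part F (snd t) = coherent_assessments F - coherent_part F (snd s)"
  using coherent_part_subset[of F "snd s"] coherent_part_subset[of F "snd t"]
  unfolding contradictories_def by blast

text \<open>
  The square alone: once the contradictories are read as complements, each of the remaining
  four conditions is equivalent to disjointness of the coherent parts of the contraries, so
  that one condition can stand for all of them.
\<close>

lemma square_of_opposition_iff:
  fixes F :: "('w cond_event)^'n"
  shows "square_of_opposition F s1 s2 s3 s4 \<longleftrightarrow>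
     sentence_on F s1 \<and> sentence_on F s2 \<and> sentence_on F s3 \<and> sentence_on F s4 \<and>
     coherent_part F (snd s1) \<inter> coherent_part F (snd s2) = {} \<and>
     coherent_part F (snd s3) = coherent_assessments F - coherent_part F (snd s2) \<and>
     coherent_part F (snd s4) = coherent_assessments F - coherent_part F (snd s1)"
proof -
  have dual: "(S - B) \<union> (S - A) = S \<longleftrightarrow> A \<inter> B = {}"
      "A \<subseteq> S - B \<longleftrightarrow> A \<inter> B = {}" "B \<subseteq> S - A \<longleftrightarrow> A \<inter> B = {}"
    if "A \<subseteq> S" "B \<subseteq> S" for A B S :: "(real^'n) set"
    using that by blast+
  note dual = dual[OF coherent_part_subset[of F "snd s1"] coherent_part_subset[of F "snd s2"]]
  show ?thesis
    unfolding square_of_opposition_def contradictories_iff_complement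
      contraries_def subcontraries_def subaltern_def
    by (rule iffI; elim conjE; intro conjI; simp only: dual)
qed

lemma hexagon_of_opposition_iff:
  fixes F :: "('w cond_event)^'n"
  shows "hexagon_of_opposition F (F, I1) (F, I2) (F, I3) (F, I4) (F, I5) (F, I6) \<longleftrightarrow>
     (\<forall>I \<in> {I1, I2, I3, I4, I5, I6}. I \<subseteq> unit_hypercube) \<and>
     coherent_part F I1 \<inter> coherent_part F I2 = {} \<and>
     coherent_part F I3 = coherent_assessments F - coherent_part F I2 \<and>
     coherent_part F I4 = coherent_assessments F - coherent_part F I1 \<and>
     coherent_part F I5 = coherent_part F I1 \<union> coherent_part F I2 \<and>
     coherent_part F I6 = coherent_assessments F - (coherent_part F I1 \<union> coherent_part F I2)"
proof -
  have de_morgan: "X = (S - B) \<inter> (S - A) \<longleftrightarrow> X = S - (A \<union> B)" for A B S X :: "(real^'n) set"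
    by (simp only: Diff_Un Int_commute)
  show ?thesis
    unfolding hexagon_of_opposition_def square_of_opposition_iff t_equivalent_def
      sentence_on_def sentence_or_def sentence_and_def
      fst_conv snd_conv coherent_part_Int coherent_part_Un
    by (simp only: ball_simps simp_thms conj_assoc de_morgan cong: conj_cong) argo
qed

lemma tripartition_iff_remainder:
  assumes "A \<subseteq> S" "B \<subseteq> S"
  shows "tripartition S (A, B, C) \<longleftrightarrow> A \<inter> B = {} \<and> C = S - (A \<union> B)"
  using assms unfolding tripartition_def prod.case by blast

theorem mainTheorem5:
  fixes F :: "('w cond_event)^'n"
    and I1 I2 I3 I4 I5 I6 :: "(real^'n) set"
  assumes "\<forall>i. is_cond_event (F $ i)"
    and "I1 \<subseteq> unit_hypercube" and "I2 \<subseteq> unit_hypercube" and "I3 \<subseteq> unit_hypercube"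
    and "I4 \<subseteq> unit_hypercube" and "I5 \<subseteq> unit_hypercube" and "I6 \<subseteq> unit_hypercube"
  shows "(hexagon_of_opposition F (F, I1) (F, I2) (F, I3) (F, I4) (F, I5) (F, I6) \<longrightarrow>
            tripartition (coherent_assessments F)
              (coherent_part F I1, coherent_part F I2, coherent_part F I6)) \<and>
         (\<forall>D1 D2 D3.
            tripartition (coherent_assessments F) (D1, D2, D3) \<and>
            coherent_part F I1 = D1 \<and>
            coherent_part F I2 = D2 \<and>
            coherent_part F I3 = D1 \<union> D3 \<and>
            coherent_part F I4 = D2 \<union> D3 \<and>
            coherent_part F I5 = D1 \<union> D2 \<and>
            coherent_part F I6 = D3 \<longrightarrow>
            hexagon_of_opposition F (F, I1) (F, I2) (F, I3) (F, I4) (F, I5) (F, I6))"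
proof -
  note hexagon = hexagon_of_opposition_iff[of F I1 I2 I3 I4 I5 I6]
  note remainder = tripartition_iff_remainder[OF coherent_part_subset coherent_part_subset]
  show ?thesis
  proof (intro conjI impI allI)
    assume "hexagon_of_opposition F (F, I1) (F, I2) (F, I3) (F, I4) (F, I5) (F, I6)"
    then show "tripartition (coherent_assessments F)
        (coherent_part F I1, coherent_part F I2, coherent_part F I6)"
      unfolding hexagon remainder by blast
  next
    fix D1 D2 D3
    assume D: "tripartition (coherent_assessments F) (D1, D2, D3) \<and>
        coherent_part F I1 = D1 \<and> coherent_part F I2 = D2 \<and>
        coherent_part F I3 = D1 \<union> D3 \<and> coherent_part F I4 = D2 \<union> D3 \<and>
        coherent_part F I5 = D1 \<union> D2 \<and> coherent_part F I6 = D3"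
    then have parts: "D1 \<inter> D2 = {}" "D1 \<union> D3 = coherent_assessments F - D2"
        "D2 \<union> D3 = coherent_assessments F - D1"
        "D3 = coherent_assessments F - (D1 \<union> D2)"
      unfolding tripartition_def prod.case by blast+
    have "\<forall>I \<in> {I1, I2, I3, I4, I5, I6}. I \<subseteq> unit_hypercube"
      using assms(2-7) by simp
    with D parts
    show "hexagon_of_opposition F (F, I1) (F, I2) (F, I3) (F, I4) (F, I5) (F, I6)"
      unfolding hexagon by metis
  qed
qed

end
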